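(* Let $P=\varrho(x,y)\,\partial_x\wedge\partial_y$ be a (possibly degenerate) Poisson bivector on $\mathbb{R}^2$. Consider the graph subcomplex of the Lichnerowicz--Poisson complex restricted to Hamiltonians on $2$ copies of $P$ (the space $\mathcal{H}_{2D}$), vector fields on $3$ copies of $P$ (the space $\mathcal{V}_{2D}$) and bivectors on $4$ copies of $P$, with differential $d_P=[\![P,\cdot]\!]$. Then the corresponding homogeneous part of the first Lichnerowicz--Poisson cohomology $H^1_{\mathrm{gra}}(\mathbb{R}^2)$ is trivial; that is, every $\vec{Y}\in\mathcal{V}_{2D}$ with $d_P(\vec{Y})=0$ is of the form $\vec{Y}=d_P(H)$ for some $H\in\mathcal{H}_{2D}$.
   Context: $[\![\cdot,\cdot]\!]$ is the Schouten bracket of multivector fields; $d_P=[\![P,\cdot]\!]$ is the Lichnerowicz--Poisson differential. A two-dimensional Kontsevich graph on $n$ Levi-Civita vertices $1,\dots,n$ and at most one sink $0$ is a weakly connected directed graph in which each Levi-Civita vertex issues an ordered pair of edges to two distinct targets (self-loops allowed), the sink issues no edges, and the sink, if present, receives exactly one edge. It is encoded by $[t_{11},t_{12};\dots;t_{n1},t_{n2}]$, where $t_{k1},t_{k2}$ are the targets of the ordered edges issued from vertex $k$. The evaluation $\phi$ sends such a graph to a function (no sink) or a vector field (one sink): decorate the $k$-th pair of edges with indices $i_{k1},i_{k2}\in\{1,2\}$; form $\prod_k\varepsilon^{i_{k1}i_{k2}}$ ($\varepsilon$ the Levi-Civita symbol, $\varepsilon^{12}=1$) times the product over Levi-Civita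 vertices of $\varrho$ differentiated with respect to $x^{i}$ ($x^1=x$, $x^2=y$) for each incoming edge with index $i$, times $\partial_{x^{i}}$ if the edge with index $i$ enters the sink; sum over all indices. $\mathcal{H}_{2D}$ is the real span of $\phi(\Gamma)$ over graphs $\Gamma$ on two Levi-Civita vertices and no sink. $\mathcal{V}_{2D}$ is the real span of $\phi(\Gamma)$ over graphs $\Gamma$ on three Levi-Civita vertices and one sink; up to isomorphism these graphs are $[0,1;2,3;1,3]$, $[0,1;1,2;1,3]$, $[0,3;2,3;2,3]$, $[0,3;2,3;1,3]$, $[0,2;2,3;1,3]$, $[0,3;1,2;1,3]$, $[0,3;2,3;1,2]$, $[0,3;1,2;1,2]$, $[0,2;2,3;1,2]$, $[0,2;1,2;1,2]$, $[0,1;1,3;1,2]$, $[0,3;1,3;1,2]$, $[0,1;1,3;2,3]$, $[0,1;1,3;1,3]$. The coefficient $\varrho$ is treated as an arbitrary (generic) smooth function: elements of these spaces are differential-polynomial expressions in $\varrho$ with constant coefficients independent of $\varrho$, and equalities such as $d_P(\vec{Y})=0$ are required to hold identically for all smooth $\varrho$. *)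

theory Defs
  imports "HOL-Analysis.Analysis" "HOL-Library.Function_Algebras"
begin

text \<open>Pointwise real vector space structure on functions, so that the library's \<open>span\<close> applies to
  differential operators.\<close>

instantiation "fun" :: (type, scaleR) scaleR
begin
definition scaleR_fun :: "real \<Rightarrow> ('a \<Rightarrow> 'b) \<Rightarrow> 'a \<Rightarrow> 'b" where
  "scaleR_fun c f = (\<lambda>x. c *\<^sub>R f x)"
instance ..
end

instance "fun" :: (type, real_vector) real_vector
  by standard (simp_all add: scaleR_fun_def fun_eq_iff algebra_simps)

section \<open>Smooth functions on the plane\<close>

definition pd :: "2 \<Rightarrow> (real^2 \<Rightarrow> real) \<Rightarrow> real^2 \<Rightarrow> real" where
  "pd i f p = deriv (\<lambda>t. f (p + t *\<^sub>R axis i 1)) 0"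

text \<open>\<open>C\<^sup>\<infinity>\<close>: all iterated partial derivatives are Frechet differentiable, in particular continuous.\<close>

definition smooth_fun :: "(real^2 \<Rightarrow> real) \<Rightarrow> bool" where
  "smooth_fun f \<longleftrightarrow> (\<forall>is. foldr pd is f differentiable_on UNIV)"

section \<open>Multivector fields and the Schouten bracket\<close>

text \<open>With anticommuting symbols \<open>\<xi>\<^sub>1 = \<partial>\<^sub>x\<close>, \<open>\<xi>\<^sub>2 = \<partial>\<^sub>y\<close>, a multivector field is a polynomial in
  \<open>\<xi>\<^sub>1, \<xi>\<^sub>2\<close> over functions: \<open>A S\<close> is the coefficient of the monomial \<open>\<xi>\<^sub>S\<close>, the product of the
  \<open>\<xi>\<^sub>i\<close>, \<open>i \<in> S\<close>, in the order \<open>1, 2\<close>. Hence \<open>A {}\<close> is the function part, \<open>A {1}\<close> and \<open>A {2}\<close> are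
  the components of the vector field part, and \<open>A {1, 2} = A UNIV\<close> is the coefficient of
  \<open>\<partial>\<^sub>x \<and> \<partial>\<^sub>y\<close>.\<close>

type_synonym mvfield = "2 set \<Rightarrow> real^2 \<Rightarrow> real"

text \<open>The index order \<open>1, 2\<close>, spelled out because \<open>2 = 0\<close> holds in the type \<^typ>\<open>2\<close>.\<close>

definition prec :: "2 \<Rightarrow> 2 \<Rightarrow> bool" where
  "prec i j \<longleftrightarrow> i = 1 \<and> j = 2"

text \<open>For disjoint \<open>S\<close> and \<open>T\<close>, \<open>\<xi>\<^sub>S \<xi>\<^sub>T = ksign S T \<xi>\<^bsub>S \<union> T\<^esub>\<close>.\<close>

definition ksign :: "2 set \<Rightarrow> 2 set \<Rightarrow> real" where
  "ksign S T = (-1) ^ card {(i, j). i \<in> S \<and> j \<in> T \<and> prec j i}"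

definition wedge :: "mvfield \<Rightarrow> mvfield \<Rightarrow> mvfield" where
  "wedge A B S p = (\<Sum>T\<in>Pow S. ksign T (S - T) * A T p * B (S - T) p)"

definition even_deriv :: "2 \<Rightarrow> mvfield \<Rightarrow> mvfield" where
  "even_deriv i A S = pd i (A S)"

text \<open>Left and right derivatives with respect to \<open>\<xi>\<^sub>i\<close>: the factor \<open>\<xi>\<^sub>i\<close> is first moved to the
  left, respectively right, end of each monomial and then dropped.\<close>

definition odd_deriv_left :: "2 \<Rightarrow> mvfield \<Rightarrow> mvfield" where
  "odd_deriv_left i A S p = (if i \<in> S then 0 else ksign {i} S * A (insert i S) p)"

definition odd_deriv_right :: "2 \<Rightarrow> mvfield \<Rightarrow> mvfield" where
  "odd_deriv_right i A S p = (if i \<in> S then 0 else ksign S {i} * A (insert i S) p)"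

text \<open>Sign convention: for \<open>P = \<rho> \<partial>\<^sub>x \<and> \<partial>\<^sub>y\<close> this bracket gives \<open>\<rho> (H\<^sub>y \<partial>\<^sub>x - H\<^sub>x \<partial>\<^sub>y)\<close> on a function \<open>H\<close>
  and \<open>(\<rho> div Y - Y(\<rho>)) \<partial>\<^sub>x \<and> \<partial>\<^sub>y\<close> on a vector field \<open>Y\<close>.\<close>

definition schouten :: "mvfield \<Rightarrow> mvfield \<Rightarrow> mvfield" where
  "schouten A B = (\<Sum>i\<in>UNIV. wedge (odd_deriv_right i A) (even_deriv i B)
                           - wedge (even_deriv i A) (odd_deriv_left i B))"

text \<open>The bivector field \<open>\<rho> \<partial>\<^sub>x \<and> \<partial>\<^sub>y\<close>; it is Poisson for every \<open>\<rho>\<close>, as there are no trivectors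
  in dimension two.\<close>

definition bivector :: "(real^2 \<Rightarrow> real) \<Rightarrow> mvfield" where
  "bivector \<rho> S p = (if S = UNIV then \<rho> p else 0)"

abbreviation dP :: "(real^2 \<Rightarrow> real) \<Rightarrow> mvfield \<Rightarrow> mvfield" where
  "dP \<rho> \<equiv> schouten (bivector \<rho>)"

section \<open>Two-dimensional Kontsevich graphs\<close>

text \<open>The list \<open>[(t\<^sub>1\<^sub>1, t\<^sub>1\<^sub>2), \<dots>, (t\<^sub>n\<^sub>1, t\<^sub>n\<^sub>2)]\<close> of the ordered target pairs of the Levi-Civita vertices
  \<open>1, \<dots>, n\<close>; the sink, if present, is the vertex \<open>0\<close>.\<close>

type_synonym kgraph = "(nat \<times> nat) list"

definition vertices :: "bool \<Rightarrow> kgraph \<Rightarrow> nat set" where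
  "vertices sink g = {1..length g} \<union> (if sink then {0} else {})"

definition arcs :: "kgraph \<Rightarrow> (nat \<times> nat) set" where
  "arcs g = (\<Union>k<length g. {(Suc k, fst (g ! k)), (Suc k, snd (g ! k))})"

definition weakly_connected :: "bool \<Rightarrow> kgraph \<Rightarrow> bool" where
  "weakly_connected sink g \<longleftrightarrow>
     (\<forall>u\<in>vertices sink g. \<forall>v\<in>vertices sink g. (u, v) \<in> (arcs g \<union> (arcs g)\<inverse>)\<^sup>*)"

text \<open>The two targets of a vertex are distinct, so \<open>0\<close> occurs at most once in each target pair.\<close>

definition kgraphs :: "nat \<Rightarrow> bool \<Rightarrow> kgraph set" where
  "kgraphs n sink = {g. length g = n \<and>
     (\<forall>(s, t)\<in>set g. s \<in> vertices sink g \<and> t \<in> vertices sink g \<and> s \<noteq> t) \<and>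
     weakly_connected sink g \<and>
     (sink \<longrightarrow> card {k. k < n \<and> (fst (g ! k) = 0 \<or> snd (g ! k) = 0)} = 1)}"

section \<open>Evaluation of graphs\<close>

definition levi_civita :: "2 \<Rightarrow> 2 \<Rightarrow> real" where
  "levi_civita i j = (if i = j then 0 else if i = 1 then 1 else -1)"

text \<open>The indices of the edges entering the vertex \<open>v\<close>, where \<open>I\<close> lists the pairs of indices that
  decorate the pairs of edges.\<close>

definition incoming :: "kgraph \<Rightarrow> (2 \<times> 2) list \<Rightarrow> nat \<Rightarrow> 2 list" where
  "incoming g I v = map snd (filter (\<lambda>(t, i). t = v)
     (concat (map2 (\<lambda>(s, t) (i, j). [(s, i), (t, j)]) g I)))"

type_synonym diffop = "(real^2 \<Rightarrow> real) \<Rightarrow> mvfield"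

text \<open>If no edge enters \<open>0\<close>, only the coefficient of \<open>\<xi>\<^bsub>{}\<^esub> = 1\<close> can be nonzero, so the value is a function.
  If one edge with index \<open>i\<close> enters \<open>0\<close>, the summand carries the factor \<open>\<xi>\<^sub>i = \<partial>/\<partial>x\<^sup>i\<close>.\<close>

definition eval_graph :: "kgraph \<Rightarrow> diffop" where
  "eval_graph g \<rho> S p = (\<Sum>I | length I = length g.
     (\<Prod>(i, j)\<leftarrow>I. levi_civita i j) *
     (\<Prod>v\<in>{1..length g}. foldr pd (incoming g I v) \<rho> p) *
     (if S = set (incoming g I 0) then 1 else 0))"

definition H2D :: "diffop set" where
  "H2D = span (eval_graph ` kgraphs 2 False)"

definition V2D :: "diffop set" where
  "V2D = span (eval_graph ` kgraphs 3 True)"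

end

theory Submission
  imports Defs
begin

text \<open>Not counting the edge into the sink, the three Levi-Civita vertices of a graph in \<open>V2D\<close> receive five
  edges, at most three each, so their in-degrees are \<open>0, 2, 3\<close> or \<open>1, 1, 3\<close> or \<open>1, 2, 2\<close>. By the
  representation theory of \<open>SL\<^sub>2\<close> each of these types admits, up to a scalar, a single vector-valued
  covariant of the jet of \<open>\<rho>\<close>: with \<open>X = (\<rho>\<^sub>y, -\<rho>\<^sub>x)\<close> and \<open>h = det Hess \<rho>\<close> they are
  \<open>\<rho> (h\<^sub>y, -h\<^sub>x) = dP h\<close>, the vector field dual to \<open>D\<^sup>3\<rho>(X, X, -)\<close>, and \<open>h X\<close>. The first one is exact.
  Evaluating \<open>dP Y = 0\<close> for the single function \<open>\<rho> = y + y\<^sup>2 + x\<^sup>3\<close> at the points \<open>(0, 0)\<close> and \<open>(0, 1)\<close>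
  shows that the other two do not occur in a cocycle.\<close>

section \<open>Partial derivatives of smooth functions\<close>

text \<open>\<open>deriv\<close> is a choice operator, so \<open>pd\<close> carries information only
  where the derivative along the axis exists; Frechet differentiability provides it by the chain
  rule.\<close>

lemma has_derivative_pd:
  assumes "f differentiable at p"
  shows "((\<lambda>t. f (p + t *\<^sub>R axis i 1)) has_real_derivative pd i f p) (at 0)"
proof -
  have "f differentiable at (p + 0 *\<^sub>R axis i 1)"
    using assms by simp
  then have "(f \<circ> (\<lambda>t. p + t *\<^sub>R axis i 1)) differentiable at (0::real)"
    by (intro differentiable_chain_at) (auto intro!: derivative_intros)
  then have "(\<lambda>t. f (p + t *\<^sub>R axis i 1)) differentiable at (0::real)"
    by (simp add: o_def)
  then show ?thesis
    unfolding pd_def by (metis DERIV_deriv_iff_real_differentiable)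
qed

lemma has_derivative_pd_line:
  assumes "f differentiable_on UNIV"
  shows "((\<lambda>t. f (p + t *\<^sub>R axis i 1)) has_real_derivative pd i f (p + t *\<^sub>R axis i 1)) (at t)"
proof -
  have "f differentiable at (p + t *\<^sub>R axis i 1)"
    using assms by (simp add: differentiable_on_def)
  from has_derivative_pd[OF this, of i]
  have "((\<lambda>s. f (p + (s + t) *\<^sub>R axis i 1)) has_real_derivative pd i f (p + t *\<^sub>R axis i 1)) (at 0)"
    by (simp add: algebra_simps)
  then show ?thesis
    using DERIV_shift[of "\<lambda>t. f (p + t *\<^sub>R axis i 1)" _ 0 t] by simp
qed

lemma pd_eqI:
  "((\<lambda>t. f (p + t *\<^sub>R axis i 1)) has_real_derivative d) (at 0) \<Longrightarrow> pd i f p = d"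
  unfolding pd_def by (rule DERIV_imp_deriv)

lemma pd_const [simp]: "pd i (\<lambda>p. c) = (\<lambda>p. 0)"
  by (rule ext, rule pd_eqI) simp

lemma pd_add:
  assumes "f differentiable_on UNIV" "g differentiable_on UNIV"
  shows "pd i (\<lambda>p. f p + g p) = (\<lambda>p. pd i f p + pd i g p)"
  using assms
  by (intro ext pd_eqI DERIV_add has_derivative_pd) (auto simp: differentiable_on_def)

lemma pd_diff:
  assumes "f differentiable_on UNIV" "g differentiable_on UNIV"
  shows "pd i (\<lambda>p. f p - g p) = (\<lambda>p. pd i f p - pd i g p)"
  using assms
  by (intro ext pd_eqI DERIV_diff has_derivative_pd) (auto simp: differentiable_on_def)

lemma pd_mult:
  assumes "f differentiable_on UNIV" "g differentiable_on UNIV"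
  shows "pd i (\<lambda>p. f p * g p) = (\<lambda>p. pd i f p * g p + f p * pd i g p)"
proof (intro ext pd_eqI)
  fix p
  show "((\<lambda>t. f (p + t *\<^sub>R axis i 1) * g (p + t *\<^sub>R axis i 1)) has_real_derivative
      pd i f p * g p + f p * pd i g p) (at 0)"
    using DERIV_mult[OF has_derivative_pd[of f p i] has_derivative_pd[of g p i]] assms
    by (simp add: differentiable_on_def algebra_simps)
qed

lemma pd_bounded_linear: "bounded_linear f \<Longrightarrow> pd i f = (\<lambda>p. f (axis i 1))"
  by (intro ext pd_eqI)
    (auto intro!: derivative_eq_intros simp: linear_simps)

lemma smooth_fun_differentiable: "smooth_fun f \<Longrightarrow> f differentiable_on UNIV"
  unfolding smooth_fun_def by (metis foldr_Nil id_apply)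

lemma smooth_fun_pd [intro]:
  assumes "smooth_fun f"
  shows "smooth_fun (pd i f)"
  unfolding smooth_fun_def
proof
  fix js
  show "foldr pd js (pd i f) differentiable_on UNIV"
    \<comment> \<open>\<open>foldr\<close> applies the last list entry first, so the extra
      derivative is appended at the end.\<close>
    using assms[unfolded smooth_fun_def, rule_format, of "js @ [i]"] by simp
qed

section \<open>Symmetry of second partial derivatives\<close>

lemma second_difference_mvt:
  fixes p :: "real^2"
  assumes "smooth_fun f" "0 < h"
  obtains s t where "\<bar>s\<bar> < h" "\<bar>t\<bar> < h"
    "f (p + h *\<^sub>R axis i 1 + h *\<^sub>R axis j 1) - f (p + h *\<^sub>R axis i 1) - f (p + h *\<^sub>R axis j 1) + f p
      = h\<^sup>2 * pd j (pd i f) (p + s *\<^sub>R axis i 1 + t *\<^sub>R axis j 1)"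
proof -
  have d: "f differentiable_on UNIV" "pd i f differentiable_on UNIV"
    using assms(1) by (auto intro: smooth_fun_differentiable)
  \<comment> \<open>The second difference is an increment in direction \<open>i\<close> of
    increments in direction \<open>j\<close>. The mean value theorem is applied to \<open>?g\<close>
    in direction \<open>i\<close>, then to \<open>pd i f\<close> in direction
    \<open>j\<close>.\<close>
  let ?g = "\<lambda>s. f (p + h *\<^sub>R axis j 1 + s *\<^sub>R axis i 1) - f (p + s *\<^sub>R axis i 1)"
  let ?g' = "\<lambda>s. pd i f (p + h *\<^sub>R axis j 1 + s *\<^sub>R axis i 1) - pd i f (p + s *\<^sub>R axis i 1)"
  have "(?g has_real_derivative ?g' s) (at s)" for s
    by (intro DERIV_diff has_derivative_pd_line d)
  then obtain s where s: "0 < s" "s < h" and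
    gs: "?g h - ?g 0 = (h - 0) * ?g' s"
    using MVT2[OF \<open>0 < h\<close>, of ?g ?g'] by blast
  let ?k = "\<lambda>t. pd i f (p + s *\<^sub>R axis i 1 + t *\<^sub>R axis j 1)"
  let ?k' = "\<lambda>t. pd j (pd i f) (p + s *\<^sub>R axis i 1 + t *\<^sub>R axis j 1)"
  have "(?k has_real_derivative ?k' t) (at t)" for t
    by (intro has_derivative_pd_line d)
  then obtain t where t: "0 < t" "t < h" and
    kt: "?k h - ?k 0 = (h - 0) * ?k' t"
    using MVT2[OF \<open>0 < h\<close>, of ?k ?k'] by blast
  show thesis
  proof
    show "\<bar>s\<bar> < h" "\<bar>t\<bar> < h" using s t by auto
    have "?g h - ?g 0 = h * (?k h - ?k 0)"
      using gs by (simp add: ac_simps)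
    then show "f (p + h *\<^sub>R axis i 1 + h *\<^sub>R axis j 1) - f (p + h *\<^sub>R axis i 1) - f (p + h *\<^sub>R axis j 1) + f p
      = h\<^sup>2 * pd j (pd i f) (p + s *\<^sub>R axis i 1 + t *\<^sub>R axis j 1)"
      unfolding kt by (simp add: ac_simps power2_eq_square)
  qed
qed

lemma second_difference_limit:
  fixes p :: "real^2"
  assumes "smooth_fun f"
  shows "((\<lambda>h. (f (p + h *\<^sub>R axis i 1 + h *\<^sub>R axis j 1) - f (p + h *\<^sub>R axis i 1)
      - f (p + h *\<^sub>R axis j 1) + f p) / h\<^sup>2) \<longlongrightarrow> pd j (pd i f) p) (at_right 0)"
    (is "(?q \<longlongrightarrow> ?L) _")
proof (rule tendstoI)
  fix e :: real
  assume "0 < e"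
  have "isCont (pd j (pd i f)) p"
    using assms by (meson UNIV_I differentiable_imp_continuous_on continuous_on_eq_continuous_at
        open_UNIV smooth_fun_differentiable smooth_fun_pd)
  then obtain d where "0 < d" and d: "\<And>q. dist q p < d \<Longrightarrow> dist (pd j (pd i f) q) ?L < e"
    using \<open>0 < e\<close> unfolding continuous_at_eps_delta by blast
  \<comment> \<open>The intermediate point lies at distance less than \<open>2 * h\<close> from
    \<open>p\<close>, hence the bound \<open>d / 2\<close>.\<close>
  have "dist (?q h) ?L < e" if h: "0 < h" "h < d / 2" for h
  proof -
    obtain s t where st: "\<bar>s\<bar> < h" "\<bar>t\<bar> < h" and
      "f (p + h *\<^sub>R axis i 1 + h *\<^sub>R axis j 1) - f (p + h *\<^sub>R axis i 1) - f (p + h *\<^sub>R axis j 1) + f p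
        = h\<^sup>2 * pd j (pd i f) (p + s *\<^sub>R axis i 1 + t *\<^sub>R axis j 1)"
      using second_difference_mvt[OF assms \<open>0 < h\<close>] by blast
    then have q: "?q h = pd j (pd i f) (p + s *\<^sub>R axis i 1 + t *\<^sub>R axis j 1)"
      using h by simp
    have "norm (s *\<^sub>R axis i (1::real) + t *\<^sub>R axis j 1 :: real^2) \<le> \<bar>s\<bar> + \<bar>t\<bar>"
      by (rule order_trans[OF norm_triangle_ineq]) simp
    then have "dist (p + s *\<^sub>R axis i 1 + t *\<^sub>R axis j 1) p < d"
      using st h by (simp add: dist_norm add.assoc)
    then show ?thesis
      unfolding q by (rule d)
  qed
  then show "\<forall>\<^sub>F h in at_right 0. dist (?q h) ?L < e"
    unfolding eventually_at_right_field using \<open>0 < d\<close> by (intro exI[of _ "d / 2"]) auto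
qed

text \<open>The second difference quotient is symmetric in \<open>i\<close> and \<open>j\<close>, so
  its limits computed in the two orders coincide.\<close>

lemma pd_commute:
  assumes "smooth_fun f"
  shows "pd i (pd j f) = pd j (pd i f)"
proof
  fix p
  show "pd i (pd j f) p = pd j (pd i f) p"
  proof (rule tendsto_unique[OF _ _ second_difference_limit[OF assms]])
    show "((\<lambda>h. (f (p + h *\<^sub>R axis i 1 + h *\<^sub>R axis j 1) - f (p + h *\<^sub>R axis i 1)
      - f (p + h *\<^sub>R axis j 1) + f p) / h\<^sup>2) \<longlongrightarrow> pd i (pd j f) p) (at_right 0)"
      using second_difference_limit[OF assms, of p j i] by (simp add: algebra_simps)
  qed simp
qed

section \<open>Smoothness of polynomials\<close>

lemma real_polynomial_function_pd:
  assumes "real_polynomial_function f"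
  shows "f differentiable_on UNIV \<and> real_polynomial_function (pd i f)"
  using assms
proof induction
  case (linear f)
  then show ?case
    by (simp add: pd_bounded_linear bounded_linear_imp_differentiable_on real_polynomial_function.intros)
next
  case (const c)
  then show ?case by (simp add: real_polynomial_function.intros)
next
  case (add f g)
  then show ?case
    by (simp add: pd_add real_polynomial_function.intros)
next
  case (mult f g)
  then show ?case
    by (auto simp: pd_mult intro!: real_polynomial_function.intros(3,4))
qed

lemma smooth_fun_polynomial:
  assumes "real_polynomial_function f"
  shows "smooth_fun f"
  unfolding smooth_fun_def
proof
  fix js
  have "real_polynomial_function (foldr pd js f)"
    by (induction js) (simp_all add: assms real_polynomial_function_pd)
  then show "foldr pd js f differentiable_on UNIV"
    using real_polynomial_function_pd by blast
qed

section \<open>Graph evaluation on jets\<close>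

definition jet :: "(real^2 \<Rightarrow> real) \<Rightarrow> real^2 \<Rightarrow> nat \<Rightarrow> nat \<Rightarrow> real" where
  "jet f p m n = (pd 1 ^^ m) ((pd 2 ^^ n) f) p"

text \<open>\<open>J\<close> is an arbitrary array, not necessarily the jet of a function:
  identities between graphs become polynomial identities in independent symbols, and graphs can be
  evaluated on formal jets.\<close>

definition jet_term :: "kgraph \<Rightarrow> (nat \<Rightarrow> nat \<Rightarrow> real) \<Rightarrow> 2 set \<Rightarrow> (2 \<times> 2) list \<Rightarrow> real" where
  "jet_term g J S I =
     (\<Prod>v\<in>{1..length g}. J (count_list (incoming g I v) 1) (count_list (incoming g I v) 2)) *
     of_bool (S = set (incoming g I 0))"

definition jet_eval :: "kgraph \<Rightarrow> (nat \<Rightarrow> nat \<Rightarrow> real) \<Rightarrow> 2 set \<Rightarrow> real" where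
  "jet_eval g J S = (\<Sum>I | length I = length g.
     (\<Prod>(i, j)\<leftarrow>I. levi_civita i j) * jet_term g J S I)"

text \<open>Smoothness is carried through the induction because commuting past one more
  \<open>pd j\<close> requires the previous iterate to be smooth.\<close>

lemma pd_funpow_commute:
  assumes "smooth_fun f"
  shows "pd i ((pd j ^^ n) f) = (pd j ^^ n) (pd i f) \<and> smooth_fun ((pd j ^^ n) f)"
  by (induction n) (auto simp: assms pd_commute[of _ i j])

lemma foldr_pd_eq_jet:
  assumes "smooth_fun f"
  shows "foldr pd is f p = jet f p (count_list is 1) (count_list is 2)"
proof -
  have "foldr pd is f = (pd 1 ^^ count_list is 1) ((pd 2 ^^ count_list is 2) f)"
  proof (induction "is")
    case (Cons i "is")
    show ?case
      using exhaust_2[of i] assms by (auto simp: Cons.IH pd_funpow_commute)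
  qed simp
  then show ?thesis by (simp add: jet_def)
qed

lemma eval_graph_eq_jet_eval:
  "smooth_fun \<rho> \<Longrightarrow> eval_graph g \<rho> S p = jet_eval g (jet \<rho> p) S"
  unfolding eval_graph_def jet_eval_def jet_term_def by (simp add: foldr_pd_eq_jet mult.assoc of_bool_def)

lemma sum_index_pairs:
  fixes f :: "2 \<times> 2 \<Rightarrow> real"
  shows "sum f UNIV = f (1, 1) + f (1, 2) + f (2, 1) + f (2, 2)"
  unfolding UNIV_Times_UNIV[symmetric] sum.cartesian_product' by (simp add: sum_2)

text \<open>Equal indices at a vertex have weight 0, so only two of the four pairs survive. Peeling
  off vertex after vertex reduces the 64 decorations of a three-vertex graph to 8.\<close>

lemma sum_levi_civita_Suc:
  fixes T :: "(2 \<times> 2) list \<Rightarrow> real"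
  shows "(\<Sum>I | length I = Suc n. (\<Prod>(i, j)\<leftarrow>I. levi_civita i j) * T I) =
    (\<Sum>I | length I = n. (\<Prod>(i, j)\<leftarrow>I. levi_civita i j) * (T ((1, 2) # I) - T ((2, 1) # I)))"
proof -
  have "{I :: (2 \<times> 2) list. length I = Suc n} = (\<lambda>(x, I). x # I) ` (UNIV \<times> {I. length I = n})"
    by (auto simp: length_Suc_conv image_iff)
  then have "(\<Sum>I | length I = Suc n. (\<Prod>(i, j)\<leftarrow>I. levi_civita i j) * T I) =
    (\<Sum>(x, I)\<in>UNIV \<times> {I. length I = n}. (\<Prod>(i, j)\<leftarrow>x # I. levi_civita i j) * T (x # I))"
    by (simp add: sum.reindex inj_on_def case_prod_unfold)
  also have "\<dots> = (\<Sum>I | length I = n. \<Sum>x\<in>UNIV. (\<Prod>(i, j)\<leftarrow>x # I. levi_civita i j) * T (x # I))"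
    by (subst sum.cartesian_product[symmetric], subst sum.swap) simp
  also have "\<dots> = (\<Sum>I | length I = n. (\<Prod>(i, j)\<leftarrow>I. levi_civita i j) * (T ((1, 2) # I) - T ((2, 1) # I)))"
    by (simp add: sum_index_pairs levi_civita_def algebra_simps)
  finally show ?thesis .
qed

section \<open>The three covariants and their coefficients\<close>

definition vec_comps :: "real \<Rightarrow> real \<Rightarrow> 2 set \<Rightarrow> real" where
  "vec_comps a b S = a * of_bool (S = {1}) + b * of_bool (S = {2})"

text \<open>The digits in the name are the in-degrees of the Levi-Civita vertices. The brackets are
  the partial derivatives of the Hessian determinant in \<open>y\<close> and in
  \<open>x\<close>.\<close>

definition cov_023 :: "(nat \<Rightarrow> nat \<Rightarrow> real) \<Rightarrow> 2 set \<Rightarrow> real" where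
  "cov_023 J = vec_comps
    (J 0 0 * (J 2 1 * J 0 2 + J 2 0 * J 0 3 - 2 * J 1 1 * J 1 2))
    (- (J 0 0 * (J 3 0 * J 0 2 + J 2 0 * J 1 2 - 2 * J 1 1 * J 2 1)))"

definition cov_113 :: "(nat \<Rightarrow> nat \<Rightarrow> real) \<Rightarrow> 2 set \<Rightarrow> real" where
  "cov_113 J = vec_comps
    (J 0 1 ^ 2 * J 2 1 - 2 * J 1 0 * J 0 1 * J 1 2 + J 1 0 ^ 2 * J 0 3)
    (- (J 0 1 ^ 2 * J 3 0 - 2 * J 1 0 * J 0 1 * J 2 1 + J 1 0 ^ 2 * J 1 2))"

definition cov_122 :: "(nat \<Rightarrow> nat \<Rightarrow> real) \<Rightarrow> 2 set \<Rightarrow> real" where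
  "cov_122 J = vec_comps
    (J 0 1 * (J 2 0 * J 0 2 - J 1 1 ^ 2))
    (- (J 1 0 * (J 2 0 * J 0 2 - J 1 1 ^ 2)))"

text \<open>On each of the following formal jets exactly one of the three covariants has a nonzero
  first component, namely \<open>1\<close>, so evaluating a graph there yields its coefficients.\<close>

definition jet_023 :: "nat \<Rightarrow> nat \<Rightarrow> real" where
  "jet_023 m n = of_bool ((m, n) \<in> {(0, 0), (2, 0), (0, 3)})"

definition jet_113 :: "nat \<Rightarrow> nat \<Rightarrow> real" where
  "jet_113 m n = of_bool ((m, n) \<in> {(1, 0), (0, 3)})"

definition jet_122 :: "nat \<Rightarrow> nat \<Rightarrow> real" where
  "jet_122 m n = of_bool ((m, n) \<in> {(0, 1), (2, 0), (0, 2)})"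

text \<open>The coefficients are values of the graph itself on the three formal jets, not
  existentially quantified numbers. Each concrete instance can thus be settled by calculation, and
  both sides are linear in \<open>jet_eval g\<close>.\<close>

definition covariant_decomp :: "kgraph \<Rightarrow> bool" where
  "covariant_decomp g \<longleftrightarrow> (\<forall>J S. jet_eval g J S =
     jet_eval g jet_023 {1} * cov_023 J S + jet_eval g jet_113 {1} * cov_113 J S +
     jet_eval g jet_122 {1} * cov_122 J S)"

lemmas covariant_defs = cov_023_def cov_113_def cov_122_def jet_023_def jet_113_def jet_122_def vec_comps_def

lemma sum_levi_civita_0:
  fixes T :: "(2 \<times> 2) list \<Rightarrow> real"
  shows "(\<Sum>I | length I = 0. (\<Prod>(i, j)\<leftarrow>I. levi_civita i j) * T I) = T []"
  by simp

lemma sum_levi_civita_3: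
  fixes T :: "(2 \<times> 2) list \<Rightarrow> real"
  shows "(\<Sum>I | length I = 3. (\<Prod>(i, j)\<leftarrow>I. levi_civita i j) * T I) =
    T [(1, 2), (1, 2), (1, 2)] - T [(1, 2), (1, 2), (2, 1)] - T [(1, 2), (2, 1), (1, 2)] + T [(1, 2), (2, 1), (2, 1)]
    - T [(2, 1), (1, 2), (1, 2)] + T [(2, 1), (1, 2), (2, 1)] + T [(2, 1), (2, 1), (1, 2)] - T [(2, 1), (2, 1), (2, 1)]"
  unfolding numeral_3_eq_3 sum_levi_civita_Suc sum_levi_civita_0 by (simp add: diff_diff_eq2)

lemma jet_eval_3:
  "length g = 3 \<Longrightarrow> jet_eval g J S =
    jet_term g J S [(1, 2), (1, 2), (1, 2)] - jet_term g J S [(1, 2), (1, 2), (2, 1)]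
    - jet_term g J S [(1, 2), (2, 1), (1, 2)] + jet_term g J S [(1, 2), (2, 1), (2, 1)]
    - jet_term g J S [(2, 1), (1, 2), (1, 2)] + jet_term g J S [(2, 1), (1, 2), (2, 1)]
    + jet_term g J S [(2, 1), (2, 1), (1, 2)] - jet_term g J S [(2, 1), (2, 1), (2, 1)]"
  unfolding jet_eval_def by (simp only: sum_levi_civita_3)

lemma jet_term_3:
  assumes "length g = 3"
  shows "jet_term g J S I =
    J (count_list (incoming g I 1) 1) (count_list (incoming g I 1) 2) *
    J (count_list (incoming g I 2) 1) (count_list (incoming g I 2) 2) *
    J (count_list (incoming g I 3) 1) (count_list (incoming g I 3) 2) *
    of_bool (S = set (incoming g I 0))"
proof -
  have "{1..length g} = {1, 2, 3}"
    using assms by auto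
  then show ?thesis
    by (simp add: jet_term_def mult.assoc)
qed

section \<open>Order of targets within an edge pair\<close>

lemma incoming_Nil [simp]: "incoming [] [] v = []"
  by (simp add: incoming_def)

lemma incoming_Cons [simp]:
  "incoming ((a, b) # g) ((i, j) # I) v =
    (if a = v then [i] else []) @ (if b = v then [j] else []) @ incoming g I v"
  by (simp add: incoming_def)

text \<open>Only the multiset of indices entering each vertex matters; it also determines the set of
  indices at the sink.\<close>

lemma jet_term_cong:
  assumes "length g = 3" "length g' = 3"
    and "\<And>v i. count_list (incoming g I v) i = count_list (incoming g' I' v) i"
  shows "jet_term g J S I = jet_term g' J S I'"
proof -
  have "set (incoming g I 0) = set (incoming g' I' 0)"
    using assms(3) by (metis (no_types, opaque_lifting) count_list_0_iff subsetI subset_antisym)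
  with assms show ?thesis by (simp add: jet_term_3)
qed

text \<open>Exchanging the two targets of a vertex amounts to exchanging its two indices, and the
  Levi-Civita symbol is antisymmetric.\<close>

lemma jet_eval_swap:
  "jet_eval [prod.swap e1, e2, e3] J S = - jet_eval [e1, e2, e3] J S"
  "jet_eval [e1, prod.swap e2, e3] J S = - jet_eval [e1, e2, e3] J S"
  "jet_eval [e1, e2, prod.swap e3] J S = - jet_eval [e1, e2, e3] J S"
proof -
  have 1: "jet_term [prod.swap e1, e2, e3] J S [(i1, j1), (i2, j2), (i3, j3)] =
      jet_term [e1, e2, e3] J S [(j1, i1), (i2, j2), (i3, j3)]" for i1 j1 i2 j2 i3 j3
    by (cases e1; cases e2; cases e3) (rule jet_term_cong; simp)
  have 2: "jet_term [e1, prod.swap e2, e3] J S [(i1, j1), (i2, j2), (i3, j3)] =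
      jet_term [e1, e2, e3] J S [(i1, j1), (j2, i2), (i3, j3)]" for i1 j1 i2 j2 i3 j3
    by (cases e1; cases e2; cases e3) (rule jet_term_cong; simp)
  have 3: "jet_term [e1, e2, prod.swap e3] J S [(i1, j1), (i2, j2), (i3, j3)] =
      jet_term [e1, e2, e3] J S [(i1, j1), (i2, j2), (j3, i3)]" for i1 j1 i2 j2 i3 j3
    by (cases e1; cases e2; cases e3) (rule jet_term_cong; simp)
  show
    "jet_eval [prod.swap e1, e2, e3] J S = - jet_eval [e1, e2, e3] J S"
    "jet_eval [e1, prod.swap e2, e3] J S = - jet_eval [e1, e2, e3] J S"
    "jet_eval [e1, e2, prod.swap e3] J S = - jet_eval [e1, e2, e3] J S"
    by (simp_all add: jet_eval_3 1 2 3)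
qed

text \<open>A swap changes the sign of the left-hand side and of all three coefficients at
  once.\<close>

lemma covariant_decomp_swap:
  "covariant_decomp [prod.swap e1, e2, e3] = covariant_decomp [e1, e2, e3]"
    "covariant_decomp [e1, prod.swap e2, e3] = covariant_decomp [e1, e2, e3]"
    "covariant_decomp [e1, e2, prod.swap e3] = covariant_decomp [e1, e2, e3]"
proof -
  have *: "- (x::real) = - a * b + - c * d + - e * f \<longleftrightarrow> x = a * b + c * d + e * f" for x a b c d e f
    by (simp add: algebra_simps) argo
  show "covariant_decomp [prod.swap e1, e2, e3] = covariant_decomp [e1, e2, e3]"
    "covariant_decomp [e1, prod.swap e2, e3] = covariant_decomp [e1, e2, e3]"
    "covariant_decomp [e1, e2, prod.swap e3] = covariant_decomp [e1, e2, e3]"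
    unfolding covariant_decomp_def jet_eval_swap * by (rule refl)+
qed

section \<open>Decomposition of all graphs\<close>

abbreviation sink_pairs :: "(nat \<times> nat) set" where
  "sink_pairs \<equiv> {(0, 1), (0, 2), (0, 3)}"

abbreviation inner_pairs :: "(nat \<times> nat) set" where
  "inner_pairs \<equiv> {(1, 2), (1, 3), (2, 3)}"

text \<open>With increasing target pairs there are 27 graphs for each position of the vertex that
  points to the sink. Each case is a polynomial identity in the entries of \<open>J\<close>, checked
  by expansion.\<close>

lemma covariant_decomp_sink_first:
  "\<forall>e1\<in>sink_pairs. \<forall>e2\<in>inner_pairs. \<forall>e3\<in>inner_pairs. covariant_decomp [e1, e2, e3]"
  by (intro ballI, elim insertE emptyE; hypsubst)
    (simp add: covariant_decomp_def jet_eval_3 jet_term_3 covariant_defs algebra_simps eval_nat_numeral)+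

lemma covariant_decomp_sink_second:
  "\<forall>e1\<in>inner_pairs. \<forall>e2\<in>sink_pairs. \<forall>e3\<in>inner_pairs. covariant_decomp [e1, e2, e3]"
  by (intro ballI, elim insertE emptyE; hypsubst)
    (simp add: covariant_decomp_def jet_eval_3 jet_term_3 covariant_defs algebra_simps eval_nat_numeral)+

lemma covariant_decomp_sink_third:
  "\<forall>e1\<in>inner_pairs. \<forall>e2\<in>inner_pairs. \<forall>e3\<in>sink_pairs. covariant_decomp [e1, e2, e3]"
  by (intro ballI, elim insertE emptyE; hypsubst)
    (simp add: covariant_decomp_def jet_eval_3 jet_term_3 covariant_defs algebra_simps eval_nat_numeral)+

lemma edge_pair_cases:
  fixes e :: "nat \<times> nat"
  assumes "fst e \<in> {0, 1, 2, 3} \<and> snd e \<in> {0, 1, 2, 3} \<and> fst e \<noteq> snd e"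
  shows "fst e = 0 \<or> snd e = 0 \<Longrightarrow>
      e \<in> sink_pairs \<or> prod.swap e \<in> sink_pairs"
    "\<not> (fst e = 0 \<or> snd e = 0) \<Longrightarrow>
      e \<in> inner_pairs \<or> prod.swap e \<in> inner_pairs"
proof -
  obtain s t where "e = (s, t)" by fastforce
  then show "fst e = 0 \<or> snd e = 0 \<Longrightarrow>
      e \<in> sink_pairs \<or> prod.swap e \<in> sink_pairs"
    "\<not> (fst e = 0 \<or> snd e = 0) \<Longrightarrow>
      e \<in> inner_pairs \<or> prod.swap e \<in> inner_pairs"
    using assms by auto
qed

lemma covariant_decomp_up_to_swap:
  assumes "\<forall>e1\<in>A. \<forall>e2\<in>B. \<forall>e3\<in>C. covariant_decomp [e1, e2, e3]"
    and "e1 \<in> A \<or> prod.swap e1 \<in> A" "e2 \<in> B \<or> prod.swap e2 \<in> B" "e3 \<in> C \<or> prod.swap e3 \<in> C"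
  shows "covariant_decomp [e1, e2, e3]"
proof -
  have "covariant_decomp [e1, f2, f3]" if "f2 \<in> B" "f3 \<in> C" for f2 f3
    using assms(1,2) that covariant_decomp_swap(1)[of e1 f2 f3] by blast
  then have "covariant_decomp [e1, e2, f3]" if "f3 \<in> C" for f3
    using assms(3) that covariant_decomp_swap(2)[of e1 e2 f3] by blast
  then show ?thesis
    using assms(4) covariant_decomp_swap(3)[of e1 e2 e3] by blast
qed

lemma kgraph_decomp:
  assumes "g \<in> kgraphs 3 True"
  shows "covariant_decomp g"
proof -
  from assms have "length g = 3"
    by (simp add: kgraphs_def)
  then obtain e1 e2 e3 where g: "g = [e1, e2, e3]"
    by (auto simp: numeral_3_eq_3 length_Suc_conv)
  have range: "fst e \<in> {0, 1, 2, 3} \<and> snd e \<in> {0, 1, 2, 3} \<and> fst e \<noteq> snd e" if "e \<in> set g" for e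
  proof -
    have "vertices True g = {0, 1, 2, 3}"
      using \<open>length g = 3\<close> by (auto simp: vertices_def)
    moreover have "case e of (s, t) \<Rightarrow> s \<in> vertices True g \<and> t \<in> vertices True g \<and> s \<noteq> t"
      using assms that by (auto simp: kgraphs_def)
    ultimately show ?thesis by (simp add: case_prod_unfold)
  qed
  define sinky where "sinky e \<longleftrightarrow> fst e = 0 \<or> snd e = 0" for e :: "nat \<times> nat"
  have sink_vertex: "e \<in> sink_pairs \<or> prod.swap e \<in> sink_pairs" if "e \<in> set g" "sinky e" for e
    by (rule edge_pair_cases(1)[OF range[OF that(1)] that(2)[unfolded sinky_def]])
  have inner_vertex: "e \<in> inner_pairs \<or> prod.swap e \<in> inner_pairs" if "e \<in> set g" "\<not> sinky e" for e
    by (rule edge_pair_cases(2)[OF range[OF that(1)] that(2)[unfolded sinky_def]])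
  have "card {k. k < 3 \<and> sinky (g ! k)} = 1"
    using assms by (simp add: kgraphs_def sinky_def)
  \<comment> \<open>The unique vertex that points to the sink selects which of the three finite
    checks applies.\<close>
  then obtain k where k: "{k. k < 3 \<and> sinky (g ! k)} = {k}"
    by (rule card_1_singletonE)
  then have "k < 3" "sinky (g ! k)" "\<And>l. l < 3 \<Longrightarrow> l \<noteq> k \<Longrightarrow> \<not> sinky (g ! l)"
    by blast+
  then consider "sinky e1" "\<not> sinky e2" "\<not> sinky e3" | "\<not> sinky e1" "sinky e2" "\<not> sinky e3"
    | "\<not> sinky e1" "\<not> sinky e2" "sinky e3"
    unfolding g numeral_3_eq_3 less_Suc_eq by fastforce
  then show ?thesis
  proof cases
    case 1
    then show ?thesis
      unfolding g by (intro covariant_decomp_up_to_swap[OF covariant_decomp_sink_first] sink_vertex inner_vertex) (simp_all add: g)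
  next
    case 2
    then show ?thesis
      unfolding g by (intro covariant_decomp_up_to_swap[OF covariant_decomp_sink_second] sink_vertex inner_vertex) (simp_all add: g)
  next
    case 3
    then show ?thesis
      unfolding g by (intro covariant_decomp_up_to_swap[OF covariant_decomp_sink_third] inner_vertex sink_vertex) (simp_all add: g)
  qed
qed

text \<open>The operators with such a decomposition on smooth functions form a subspace containing
  all graph evaluations, hence also their span.\<close>

lemma V2D_decomp:
  assumes "Y \<in> V2D"
  obtains a b c where "\<And>\<rho> S p. smooth_fun \<rho> \<Longrightarrow>
    Y \<rho> S p = a * cov_023 (jet \<rho> p) S + b * cov_113 (jet \<rho> p) S + c * cov_122 (jet \<rho> p) S"
proof -
  let ?comb = "\<lambda>a b c. \<lambda>\<rho> S p. a * cov_023 (jet \<rho> p) S + b * cov_113 (jet \<rho> p) S + c * cov_122 (jet \<rho> p) S"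
  let ?W = "{Y :: diffop. \<exists>a b c. \<forall>\<rho> S p. smooth_fun \<rho> \<longrightarrow> Y \<rho> S p = ?comb a b c \<rho> S p}"
  have "subspace ?W"
  proof (rule subspaceI)
    show "0 \<in> ?W"
      by (auto intro!: exI[of _ 0])
  next
    fix X Y assume "X \<in> ?W" "Y \<in> ?W"
    then obtain a b c a' b' c' where "\<forall>\<rho> S p. smooth_fun \<rho> \<longrightarrow> X \<rho> S p = ?comb a b c \<rho> S p"
      "\<forall>\<rho> S p. smooth_fun \<rho> \<longrightarrow> Y \<rho> S p = ?comb a' b' c' \<rho> S p"
      by blast
    then have "\<forall>\<rho> S p. smooth_fun \<rho> \<longrightarrow> (X + Y) \<rho> S p = ?comb (a + a') (b + b') (c + c') \<rho> S p"
      by (simp add: algebra_simps)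
    then show "X + Y \<in> ?W" by blast
  next
    fix r X assume "X \<in> ?W"
    then obtain a b c where "\<forall>\<rho> S p. smooth_fun \<rho> \<longrightarrow> X \<rho> S p = ?comb a b c \<rho> S p"
      by blast
    then have "\<forall>\<rho> S p. smooth_fun \<rho> \<longrightarrow> (r *\<^sub>R X) \<rho> S p = ?comb (r * a) (r * b) (r * c) \<rho> S p"
      by (simp add: scaleR_fun_def algebra_simps)
    then show "r *\<^sub>R X \<in> ?W" by blast
  qed
  moreover have "eval_graph ` kgraphs 3 True \<subseteq> ?W"
  proof (rule image_subsetI)
    fix g assume "g \<in> kgraphs 3 True"
    then have "covariant_decomp g" by (rule kgraph_decomp)
    then have "\<forall>\<rho> S p. smooth_fun \<rho> \<longrightarrow>
        eval_graph g \<rho> S p =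
          ?comb (jet_eval g jet_023 {1}) (jet_eval g jet_113 {1}) (jet_eval g jet_122 {1}) \<rho> S p"
      by (metis covariant_decomp_def eval_graph_eq_jet_eval)
    then show "eval_graph g \<in> ?W" by blast
  qed
  ultimately have "V2D \<subseteq> ?W"
    unfolding V2D_def by (simp add: span_minimal)
  with assms that show thesis by blast
qed

section \<open>The differential\<close>

lemma ksign_simps [simp]:
  "ksign {} S = 1" "ksign S {} = 1" "ksign {1} {2} = 1" "ksign {2} {1} = -1"
proof -
  have "{(i, j). i \<in> {1} \<and> j \<in> {2} \<and> prec j i} = {}" "{(i, j). i \<in> {2} \<and> j \<in> {1} \<and> prec j i} = {(2, 1)}"
    by (auto simp: prec_def)
  then show "ksign {1} {2} = 1" "ksign {2} {1} = -1"
    unfolding ksign_def by (simp_all only:) simp_all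
qed (simp_all add: ksign_def)

lemma wedge_simps:
  "wedge A B {} p = A {} p * B {} p"
  "wedge A B {i} p = A {} p * B {i} p + A {i} p * B {} p"
  "wedge A B UNIV p = A {} p * B UNIV p + A {1} p * B {2} p - A {2} p * B {1} p + A UNIV p * B {} p"
proof -
  show "wedge A B {} p = A {} p * B {} p"
    by (simp add: wedge_def)
  show "wedge A B {i} p = A {} p * B {i} p + A {i} p * B {} p"
    by (simp add: wedge_def Pow_insert)
  have "{1, 2} - {1} = {2 :: 2}" "{1, 2} - {2} = {1 :: 2}" "{} \<noteq> {1 :: 2, 2}" by auto
  then show "wedge A B UNIV p = A {} p * B UNIV p + A {1} p * B {2} p - A {2} p * B {1} p + A UNIV p * B {} p"
    by (auto simp: wedge_def UNIV_2 Pow_insert)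
qed

lemma subsets_2: "S = {} \<or> S = {1} \<or> S = {2} \<or> S = (UNIV :: 2 set)"
proof -
  have "S \<in> Pow {1, 2}"
    using UNIV_2 by auto
  then show ?thesis
    unfolding UNIV_2 by (auto simp: Pow_insert)
qed

lemma index_sets_distinct [simp]:
  "{i :: 2} \<noteq> UNIV" "UNIV \<noteq> {i :: 2}"
  by (auto simp: UNIV_2)

lemma odd_deriv_right_bivector [simp]:
  "odd_deriv_right i (bivector \<rho>) {} p = 0"
  "odd_deriv_right 1 (bivector \<rho>) {2} p = - \<rho> p"
  "odd_deriv_right 2 (bivector \<rho>) {1} p = \<rho> p"
  "odd_deriv_right i (bivector \<rho>) {i} p = 0"
  "odd_deriv_right i (bivector \<rho>) UNIV p = 0"
proof -
  have "{1, 2} = (UNIV :: 2 set)" "{2, 1} = (UNIV :: 2 set)"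
    by (auto simp: UNIV_2)
  then show "odd_deriv_right 1 (bivector \<rho>) {2} p = - \<rho> p" "odd_deriv_right 2 (bivector \<rho>) {1} p = \<rho> p"
    by (simp_all add: odd_deriv_right_def bivector_def)
qed (simp_all add: odd_deriv_right_def bivector_def)

lemma even_deriv_bivector [simp]:
  "even_deriv i (bivector \<rho>) {} p = 0"
  "even_deriv i (bivector \<rho>) {j} p = 0"
  "even_deriv i (bivector \<rho>) UNIV p = pd i \<rho> p"
  by (simp_all add: even_deriv_def bivector_def[abs_def])

text \<open>This is \<rho> div A - A(\<rho>) for the vector field part of \<open>A\<close>, the only
  component of the differential that the cocycle test uses.\<close>

lemma dP_UNIV:
  "dP \<rho> A UNIV p = \<rho> p * (pd 1 (A {1}) p + pd 2 (A {2}) p) - (pd 1 \<rho> p * A {1} p + pd 2 \<rho> p * A {2} p)"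
  by (simp add: schouten_def sum_2 wedge_simps) (simp add: odd_deriv_left_def even_deriv_def algebra_simps)

text \<open>The result is the Hamiltonian vector field of the function part of
  \<open>A\<close>.\<close>

lemma dP_function:
  assumes "\<And>S p. S \<noteq> {} \<Longrightarrow> A S p = 0"
  shows "dP \<rho> A S p = vec_comps (\<rho> p * pd 2 (A {}) p) (- (\<rho> p * pd 1 (A {}) p)) S"
proof -
  have left: "odd_deriv_left i A T q = 0" for i T q
    by (simp add: odd_deriv_left_def assms)
  have even: "even_deriv i A T q = (if T = {} then pd i (A {}) q else 0)" for i T q
  proof (cases "T = {}")
    case False
    then have "A T = (\<lambda>p. 0)"
      using assms by blast
    with False show ?thesis by (simp add: even_deriv_def)
  qed (simp add: even_deriv_def)
  from subsets_2[of S] show ?thesis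
    by (elim disjE) (simp_all add: schouten_def sum_2 wedge_simps left even vec_comps_def)
qed

section \<open>Exactness of the first covariant\<close>

lemma jet_0_0: "jet f p 0 0 = f p"
  by (simp add: jet_def)

lemma pd_jet:
  assumes "smooth_fun f"
  shows "pd 1 (\<lambda>p. jet f p m n) = (\<lambda>p. jet f p (Suc m) n)"
    "pd 2 (\<lambda>p. jet f p m n) = (\<lambda>p. jet f p m (Suc n))"
    "(\<lambda>p. jet f p m n) differentiable_on UNIV"
proof -
  have *: "smooth_fun ((pd 2 ^^ n) f)"
    using assms pd_funpow_commute by blast
  then show "(\<lambda>p. jet f p m n) differentiable_on UNIV"
    unfolding jet_def using pd_funpow_commute smooth_fun_differentiable by blast
  show "pd 1 (\<lambda>p. jet f p m n) = (\<lambda>p. jet f p (Suc m) n)"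
    unfolding jet_def by simp
  \<comment> \<open>\<open>jet\<close> keeps the derivatives \<open>pd 1\<close> outermost, so the
    new \<open>pd 2\<close> has to be moved inside past all of them.\<close>
  show "pd 2 (\<lambda>p. jet f p m n) = (\<lambda>p. jet f p m (Suc n))"
    unfolding jet_def using pd_funpow_commute[OF *, where i = 2 and j = 1 and n = m] by simp
qed

text \<open>Both vertices point to both vertices, so each has a self-loop. The graph evaluates to
  twice the Hessian determinant.\<close>

definition hess_graph :: kgraph where
  "hess_graph = [(1, 2), (1, 2)]"

lemma hess_graph_kgraph: "hess_graph \<in> kgraphs 2 False"
proof -
  have v: "vertices False hess_graph = {1, 2}"
    by (auto simp: vertices_def hess_graph_def)
  have "(1, 2) \<in> arcs hess_graph"
    unfolding arcs_def hess_graph_def by (auto intro!: exI[of _ 0])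
  then have "(1, 2) \<in> (arcs hess_graph \<union> (arcs hess_graph)\<inverse>)\<^sup>*" "(2, 1) \<in> (arcs hess_graph \<union> (arcs hess_graph)\<inverse>)\<^sup>*"
    by auto
  then have "weakly_connected False hess_graph"
    by (simp add: weakly_connected_def v)
  then show ?thesis
    unfolding kgraphs_def using v by (simp add: hess_graph_def)
qed

text \<open>Equal index pairs at the two vertices give the product of the pure second derivatives,
  opposite ones give minus the square of the mixed one; each occurs twice.\<close>

lemma eval_hess_graph:
  assumes "smooth_fun \<rho>"
  shows "eval_graph hess_graph \<rho> S p =
    of_bool (S = {}) * (2 * (jet \<rho> p 2 0 * jet \<rho> p 0 2 - jet \<rho> p 1 1 ^ 2))"
proof -
  have "{Suc 0..Suc (Suc 0)} = {Suc 0, Suc (Suc 0)}" by auto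
  then show ?thesis
    unfolding eval_graph_eq_jet_eval[OF assms] jet_eval_def hess_graph_def
    by (simp add: numeral_2_eq_2 sum_levi_civita_Suc sum_levi_civita_0 jet_term_def)
qed

text \<open>The factor \<open>a / 2\<close> compensates the 2 in the value of the graph; the product
  rule then yields the derivatives of the Hessian determinant.\<close>

lemma dP_hess_graph:
  assumes "smooth_fun \<rho>"
  shows "dP \<rho> (((a / 2) *\<^sub>R eval_graph hess_graph) \<rho>) S p = a * cov_023 (jet \<rho> p) S"
proof -
  let ?A = "((a / 2) *\<^sub>R eval_graph hess_graph) \<rho>"
  have A: "?A T q = of_bool (T = {}) * (a * (jet \<rho> q 2 0 * jet \<rho> q 0 2 - jet \<rho> q 1 1 * jet \<rho> q 1 1))" for T q
    using assms by (simp add: scaleR_fun_def eval_hess_graph power2_eq_square)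
  then have "?A {} = (\<lambda>q. a * (jet \<rho> q 2 0 * jet \<rho> q 0 2 - jet \<rho> q 1 1 * jet \<rho> q 1 1))"
    by auto
  moreover note pd_jet[OF assms]
  moreover have "?A T q = 0" if "T \<noteq> {}" for T q
    using A that by simp
  ultimately show ?thesis
    by (subst dP_function)
     (simp_all add: pd_mult pd_diff vec_comps_def cov_023_def jet_0_0 algebra_simps eval_nat_numeral)
qed

section \<open>The cocycle condition on a test function\<close>

lemma pd_coordinates:
  fixes F D :: "real \<Rightarrow> real \<Rightarrow> real"
  shows "(\<And>x y. ((\<lambda>x. F x y) has_real_derivative D x y) (at x)) \<Longrightarrow>
      pd 1 (\<lambda>p. F (p $ 1) (p $ 2)) = (\<lambda>p. D (p $ 1) (p $ 2))"
    "(\<And>x y. ((\<lambda>y. F x y) has_real_derivative D x y) (at y)) \<Longrightarrow>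
      pd 2 (\<lambda>p. F (p $ 1) (p $ 2)) = (\<lambda>p. D (p $ 1) (p $ 2))"
proof -
  have *: "((\<lambda>t. G (z + t)) has_real_derivative d) (at 0)" if "(G has_real_derivative d) (at z)" for G d and z :: real
    using that DERIV_shift[of G d 0 z] by (simp add: add.commute)
  show "pd 1 (\<lambda>p. F (p $ 1) (p $ 2)) = (\<lambda>p. D (p $ 1) (p $ 2))"
    if "\<And>x y. ((\<lambda>x. F x y) has_real_derivative D x y) (at x)"
    by (intro ext pd_eqI) (simp add: axis_def *[OF that])
  show "pd 2 (\<lambda>p. F (p $ 1) (p $ 2)) = (\<lambda>p. D (p $ 1) (p $ 2))"
    if "\<And>x y. ((\<lambda>y. F x y) has_real_derivative D x y) (at y)"
    by (intro ext pd_eqI) (simp add: axis_def *[OF that])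
qed

lemma cocycle_coefficients:
  assumes "\<And>\<rho> S p. smooth_fun \<rho> \<Longrightarrow>
      Y \<rho> S p = a * cov_023 (jet \<rho> p) S + b * cov_113 (jet \<rho> p) S + c * cov_122 (jet \<rho> p) S"
    and "\<And>\<rho>. smooth_fun \<rho> \<Longrightarrow> dP \<rho> (Y \<rho>) = 0"
  shows "b = 0 \<and> c = 0"
proof -
  \<comment> \<open>The cubic term gives a nonzero third derivative, which detects \<open>b\<close>.
    Together with the square it makes the Hessian determinant \<open>12 * x\<close>, whose slope
    detects \<open>c\<close> through the divergence.\<close>
  define f :: "real^2 \<Rightarrow> real" where "f = (\<lambda>p. p $ 2 + (p $ 2)^2 + (p $ 1)^3)"
  have "real_polynomial_function f"
    unfolding f_def power2_eq_square power3_eq_cube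
    by (intro real_polynomial_function.intros bounded_linear_vec_nth)
  then have smooth: "smooth_fun f"
    by (rule smooth_fun_polynomial)
  have jets: "pd 2 f = (\<lambda>p. 1 + 2 * p $ 2)" "pd 1 f = (\<lambda>p. 3 * (p $ 1)^2)"
    "pd 2 (\<lambda>p. 1 + 2 * p $ 2) = (\<lambda>p. 2)" "pd 1 (\<lambda>p. 1 + 2 * p $ 2) = (\<lambda>p. 0)"
    "pd 1 (\<lambda>p. 3 * (p $ 1)^2) = (\<lambda>p. 6 * p $ 1)" "pd 1 (\<lambda>p. 6 * p $ 1) = (\<lambda>p. 6)"
    unfolding f_def
    by (rule pd_coordinates; auto intro!: derivative_eq_intros)+
  have funpow: "(F ^^ 2) x = F (F x)" "(F ^^ 3) x = F (F (F x))" for F :: "'a \<Rightarrow> 'a" and x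
    by (simp_all add: eval_nat_numeral)
  have Y1: "Y f {1} = (\<lambda>p. 12 * c * (1 + 2 * p $ 2) * p $ 1)"
    by (rule ext) (simp add: assms(1)[OF smooth] covariant_defs jet_def jets funpow)
  have Y2: "Y f {2} = (\<lambda>p. - 12 * a * (p $ 2 + (p $ 2)^2 + (p $ 1)^3) - 6 * b * (1 + 2 * p $ 2)^2 - 36 * c * (p $ 1)^3)"
    by (rule ext, simp add: assms(1)[OF smooth] covariant_defs jet_def jets funpow)
      (simp add: f_def algebra_simps power2_eq_square power3_eq_cube)
  have dY1: "pd 1 (Y f {1}) = (\<lambda>p. 12 * c * (1 + 2 * p $ 2))"
    unfolding Y1 by (rule pd_coordinates) (auto intro!: derivative_eq_intros)
  have dY2: "pd 2 (Y f {2}) = (\<lambda>p. (- 12 * a - 24 * b) * (1 + 2 * p $ 2))"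
    unfolding Y2 by (rule pd_coordinates) (auto intro!: derivative_eq_intros simp: algebra_simps)
  have dP: "0 = f p * (pd 1 (Y f {1}) p + pd 2 (Y f {2}) p) - (pd 1 f p * Y f {1} p + pd 2 f p * Y f {2} p)" for p
    using dP_UNIV[of f "Y f" p] assms(2)[OF smooth] by simp
  have f: "f 0 = 0" "f (axis 2 1) = 2"
    by (simp_all add: f_def axis_def)
  \<comment> \<open>At the origin \<open>f\<close> and its \<open>x\<close>-derivative vanish and
    its \<open>y\<close>-derivative is 1, so the condition reduces to
    \<open>6 * b = 0\<close>.\<close>
  have "b = 0"
    using dP[of 0] by (simp add: dY1 dY2 jets f) (simp add: Y1 Y2)
  \<comment> \<open>At the point (0, 1), \<open>f = 2\<close> and the gradient is (0, 3). The terms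
    in \<open>a\<close> cancel, as exactness of \<open>cov_023\<close> predicts, leaving
    \<open>72 * c = 0\<close>.\<close>
  moreover have "c = 0"
    using dP[of "axis 2 1"] \<open>b = 0\<close> by (simp add: dY1 dY2 jets f) (simp add: Y1 Y2 axis_def)
  ultimately show ?thesis ..
qed

theorem theorem6:
  fixes Y :: diffop
  assumes "Y \<in> V2D"
    and "\<forall>\<rho>. smooth_fun \<rho> \<longrightarrow> dP \<rho> (Y \<rho>) = 0"
  shows "\<exists>H\<in>H2D. \<forall>\<rho>. smooth_fun \<rho> \<longrightarrow> Y \<rho> = dP \<rho> (H \<rho>)"
proof -
  obtain a b c where Y: "\<And>\<rho> S p. smooth_fun \<rho> \<Longrightarrow>
      Y \<rho> S p = a * cov_023 (jet \<rho> p) S + b * cov_113 (jet \<rho> p) S + c * cov_122 (jet \<rho> p) S"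
    using V2D_decomp[OF assms(1)] by blast
  with assms(2) have "b = 0 \<and> c = 0"
    using cocycle_coefficients[of Y a b c] by blast
  \<comment> \<open>The coefficient \<open>a\<close> was fixed before \<rho>, so a single
    Hamiltonian operator serves all smooth \<rho>.\<close>
  then have "Y \<rho> = dP \<rho> (((a / 2) *\<^sub>R eval_graph hess_graph) \<rho>)" if "smooth_fun \<rho>" for \<rho>
    using that by (intro ext) (simp add: Y dP_hess_graph)
  moreover have "(a / 2) *\<^sub>R eval_graph hess_graph \<in> H2D"
    unfolding H2D_def by (intro span_mul span_base imageI hess_graph_kgraph)
  ultimately show ?thesis by blast
qed

end
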